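(* Let $\Phi := \{\varphi_i\}_{i \in I}$ be a frame for $\mathscr{H}$ with lower and upper frame bounds $A$ and $B$ respectively. Then all three of the unconditional constants $C_\sigma, C_\varepsilon, C_a$ of the frame expansions with respect to $\Phi$ are bounded above by $\sqrt{\frac{B}{A}}$. That is: (i) For any $\sigma \subset I$ and for every $x \in \mathscr{H}$, $$\left\lVert \sum_{i \in \sigma} \langle x, \varphi_i\rangle \varphi_i \right\rVert \leq \sqrt{\frac{B}{A}}\, \left\lVert \sum_{i \in I} \langle x, \varphi_i\rangle \varphi_i \right\rVert .$$ (ii) For any sequence $\{\varepsilon_i\}_{i\in I}$ with $\varepsilon_i \in \{-1,1\}$ for all $i$, and for every $x \in \mathscr{H}$, $$\left\lVert \sum_{i \in I} \varepsilon_i \langle x, \varphi_i\rangle \varphi_i \right\rVert \leq \sqrt{\frac{B}{A}}\, \left\lVert \sum_{i \in I} \langle x, \varphi_i\rangle \varphi_i \right\rVert .$$ (iii) For every sequence of real numbers $\{a_i\}_{i \in I}$ with $|a_i| \leq 1$ for all $i$, and for every $x \in \mathscr{H}$, $$\left\lVert \sum_{i \in I} a_i \langle x, \varphi_i\rangle \varphi_i \right\rVert \leq \sqrt{\frac{B}{A}}\, \left\lVert \sum_{i \in I} \langle x, \varphi_i\rangle \varphi_i \right\rVert .$$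
   Context: $\mathscr{H}$ is a separable, finite or infinite dimensional, real or complex Hilbert space. The index set $I$ is either $\{1,\dots,N\}$ or $\mathbb{N}$. A family $\{\varphi_i\}_{i\in I}$ in $\mathscr{H}$ is a frame for $\mathscr{H}$ if there are constants $0<A\le B<\infty$ with $A\|x\|^2\le \sum_{i\in I}|\langle x,\varphi_i\rangle|^2\le B\|x\|^2$ for all $x\in\mathscr{H}$; $A$ is a lower and $B$ an upper frame bound. Stated frame bounds are always assumed optimal: $A$ is the largest and $B$ the smallest possible value. The frame expansion of $x\in\mathscr{H}$ is $\sum_{i\in I}\langle x,\varphi_i\rangle\varphi_i$. The unconditional constants of the frame expansions are the smallest constants $C_\sigma, C_\varepsilon, C_a$ such that, for all $x\in\mathscr{H}$, $\|\sum_{i\in\sigma}\langle x,\varphi_i\rangle\varphi_i\|\le C_\sigma\|\sum_{i\in I}\langle x,\varphi_i\rangle\varphi_i\|$ for all $\sigma\subset I$; $\|\sum_{i\in I}\varepsilon_i\langle x,\varphi_i\rangle\varphi_i\|\le C_\varepsilon\|\sum_{i\in I}\langle x,\varphi_i\rangle\varphi_i\|$ for all $\varepsilon_i\in\{-1,1\}$; and $\|\sum_{i\in I}a_i\langle x,\varphi_i\rangle\varphi_i\|\le C_a\|\sum_{i\in I}\langle x,\varphi_i\rangle\varphi_i\|$ for all scalars $a_i$ with $|a_i|\le1$. *)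

theory Defs
  imports "HOL-Analysis.Analysis"
begin

text \<open>
  The scalar field is real or complex. The class below makes both cases available at once;
  its two instances are the intended scalar fields. There are no others up to isometric
  isomorphism, by the Gelfand--Mazur theorem. All usual laws of conjugation follow from the
  two axioms.
\<close>

class real_or_complex = real_normed_field +
  fixes conjugate :: "'a \<Rightarrow> 'a"
  assumes conjugate_add: "conjugate (a + b) = conjugate a + conjugate b"
    and mult_conjugate: "a * conjugate a = (norm a)\<^sup>2 *\<^sub>R 1"

instantiation real :: real_or_complex
begin
definition conjugate_real :: "real \<Rightarrow> real" where "conjugate_real a = a"
instance by standard (simp_all add: conjugate_real_def power2_eq_square)
end

instantiation complex :: real_or_complex
begin
definition conjugate_complex :: "complex \<Rightarrow> complex" where "conjugate_complex a = cnj a"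
instance by standard (simp_all add: conjugate_complex_def scaleR_conv_of_real flip: complex_norm_square)
end

text \<open>
  A Hilbert space over \<open>'k\<close>. Completeness and the topology come from the class \<open>banach\<close>; the
  norm is the one induced by \<open>ip\<close>, and the scalar multiplication extends the real one that
  the class provides. The inner product is linear in its first argument.
\<close>

locale hilbert_space = vector_space scale
  for scale :: "'k::real_or_complex \<Rightarrow> 'h::banach \<Rightarrow> 'h" +
  fixes ip :: "'h \<Rightarrow> 'h \<Rightarrow> 'k"
  assumes scale_of_real: "scale (of_real r) x = r *\<^sub>R x"
    and ip_add_left: "ip (x + y) z = ip x z + ip y z"
    and ip_scale_left: "ip (scale c x) y = c * ip x y"
    and ip_commute: "ip y x = conjugate (ip x y)"
    and ip_self: "ip x x = of_real ((norm x)\<^sup>2)"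

lemma hilbert_space_real:
  "hilbert_space (scaleR :: real \<Rightarrow> 'a::{real_inner, banach} \<Rightarrow> 'a) inner"
  by unfold_locales
    (simp_all add: conjugate_real_def inner_commute inner_add_left inner_add_right scaleR_add_right
      scaleR_add_left power2_norm_eq_inner)

lemma hilbert_space_complex:
  "hilbert_space ((*) :: complex \<Rightarrow> complex \<Rightarrow> complex) (\<lambda>x y. x * cnj y)"
  by unfold_locales
    (simp_all add: conjugate_complex_def algebra_simps scaleR_conv_of_real flip: complex_norm_square)

text \<open>
  A family indexed by \<open>I\<close> is a function on \<open>nat\<close>, of which only the values on \<open>I\<close> matter.
  Sums are unordered; since \<open>infsum\<close> is 0 by convention for a family that is not summable,
  convergence is always stated along with an inequality.
\<close>

definition lower_frame_bound ::
  "('h::banach \<Rightarrow> 'h \<Rightarrow> 'k::real_or_complex) \<Rightarrow> nat set \<Rightarrow> (nat \<Rightarrow> 'h) \<Rightarrow> real \<Rightarrow> bool" where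
  "lower_frame_bound ip I \<phi> A \<longleftrightarrow> 0 < A \<and>
     (\<forall>x. (\<lambda>i. (norm (ip x (\<phi> i)))\<^sup>2) summable_on I \<and>
          A * (norm x)\<^sup>2 \<le> (\<Sum>\<^sub>\<infinity>i\<in>I. (norm (ip x (\<phi> i)))\<^sup>2))"

definition upper_frame_bound ::
  "('h::banach \<Rightarrow> 'h \<Rightarrow> 'k::real_or_complex) \<Rightarrow> nat set \<Rightarrow> (nat \<Rightarrow> 'h) \<Rightarrow> real \<Rightarrow> bool" where
  "upper_frame_bound ip I \<phi> B \<longleftrightarrow> 0 < B \<and>
     (\<forall>x. (\<lambda>i. (norm (ip x (\<phi> i)))\<^sup>2) summable_on I \<and>
          (\<Sum>\<^sub>\<infinity>i\<in>I. (norm (ip x (\<phi> i)))\<^sup>2) \<le> B * (norm x)\<^sup>2)"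

definition is_frame ::
  "('h::banach \<Rightarrow> 'h \<Rightarrow> 'k::real_or_complex) \<Rightarrow> nat set \<Rightarrow> (nat \<Rightarrow> 'h) \<Rightarrow> bool" where
  "is_frame ip I \<phi> \<longleftrightarrow>
     (\<exists>A B. A \<le> B \<and> lower_frame_bound ip I \<phi> A \<and> upper_frame_bound ip I \<phi> B)"

definition optimal_frame_bounds ::
  "('h::banach \<Rightarrow> 'h \<Rightarrow> 'k::real_or_complex) \<Rightarrow> nat set \<Rightarrow> (nat \<Rightarrow> 'h) \<Rightarrow> real \<Rightarrow> real \<Rightarrow> bool"
  where
  "optimal_frame_bounds ip I \<phi> A B \<longleftrightarrow>
     lower_frame_bound ip I \<phi> A \<and> (\<forall>A'. lower_frame_bound ip I \<phi> A' \<longrightarrow> A' \<le> A) \<and>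
     upper_frame_bound ip I \<phi> B \<and> (\<forall>B'. upper_frame_bound ip I \<phi> B' \<longrightarrow> B \<le> B')"

definition frame_term ::
  "('k \<Rightarrow> 'h \<Rightarrow> 'h) \<Rightarrow> ('h::banach \<Rightarrow> 'h \<Rightarrow> 'k::real_or_complex) \<Rightarrow> (nat \<Rightarrow> 'h) \<Rightarrow>
   'h \<Rightarrow> nat \<Rightarrow> 'h" where
  "frame_term smul ip \<phi> x i = smul (ip x (\<phi> i)) (\<phi> i)"

definition frame_expansion ::
  "('k \<Rightarrow> 'h \<Rightarrow> 'h) \<Rightarrow> ('h::banach \<Rightarrow> 'h \<Rightarrow> 'k::real_or_complex) \<Rightarrow> nat set \<Rightarrow>
   (nat \<Rightarrow> 'h) \<Rightarrow> 'h \<Rightarrow> 'h" where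
  "frame_expansion smul ip I \<phi> x = (\<Sum>\<^sub>\<infinity>i\<in>I. frame_term smul ip \<phi> x i)"

definition C_sigma ::
  "('k \<Rightarrow> 'h \<Rightarrow> 'h) \<Rightarrow> ('h::banach \<Rightarrow> 'h \<Rightarrow> 'k::real_or_complex) \<Rightarrow> nat set \<Rightarrow>
   (nat \<Rightarrow> 'h) \<Rightarrow> real" where
  "C_sigma smul ip I \<phi> = (LEAST C. \<forall>x. \<forall>\<sigma>\<subseteq>I.
     frame_term smul ip \<phi> x summable_on \<sigma> \<and>
     norm (\<Sum>\<^sub>\<infinity>i\<in>\<sigma>. frame_term smul ip \<phi> x i)
       \<le> C * norm (frame_expansion smul ip I \<phi> x))"

definition C_epsilon ::
  "('k \<Rightarrow> 'h \<Rightarrow> 'h) \<Rightarrow> ('h::banach \<Rightarrow> 'h \<Rightarrow> 'k::real_or_complex) \<Rightarrow> nat set \<Rightarrow>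
   (nat \<Rightarrow> 'h) \<Rightarrow> real" where
  "C_epsilon smul ip I \<phi> = (LEAST C. \<forall>x. \<forall>\<epsilon> :: nat \<Rightarrow> 'k. (\<forall>i\<in>I. \<epsilon> i \<in> {-1, 1}) \<longrightarrow>
     (\<lambda>i. smul (\<epsilon> i) (frame_term smul ip \<phi> x i)) summable_on I \<and>
     norm (\<Sum>\<^sub>\<infinity>i\<in>I. smul (\<epsilon> i) (frame_term smul ip \<phi> x i))
       \<le> C * norm (frame_expansion smul ip I \<phi> x))"

definition C_a ::
  "('k \<Rightarrow> 'h \<Rightarrow> 'h) \<Rightarrow> ('h::banach \<Rightarrow> 'h \<Rightarrow> 'k::real_or_complex) \<Rightarrow> nat set \<Rightarrow>
   (nat \<Rightarrow> 'h) \<Rightarrow> real" where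
  "C_a smul ip I \<phi> = (LEAST C. \<forall>x. \<forall>a :: nat \<Rightarrow> 'k. (\<forall>i\<in>I. norm (a i) \<le> 1) \<longrightarrow>
     (\<lambda>i. smul (a i) (frame_term smul ip \<phi> x i)) summable_on I \<and>
     norm (\<Sum>\<^sub>\<infinity>i\<in>I. smul (a i) (frame_term smul ip \<phi> x i))
       \<le> C * norm (frame_expansion smul ip I \<phi> x))"

end

theory Submission
  imports Defs
begin

text \<open>
  Fix \<open>x\<close> and put \<open>Q = \<Sum>\<bar>\<langle>x, \<phi>\<^sub>i\<rangle>\<bar>\<^sup>2\<close> and \<open>S x = \<Sum>\<langle>x, \<phi>\<^sub>i\<rangle> \<phi>\<^sub>i\<close>. All three families of
  inequalities are the two estimates
  \<open>\<parallel>\<Sum>a\<^sub>i \<langle>x, \<phi>\<^sub>i\<rangle> \<phi>\<^sub>i\<parallel>\<^sup>2 \<le> B * Q\<close> and \<open>A * Q \<le> \<parallel>S x\<parallel>\<^sup>2\<close> put together, where \<open>\<bar>a\<^sub>i\<bar> \<le> 1\<close>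
  and the first sum may run over any part of the index set.

  The first estimate says that the synthesis map, being adjoint to the analysis map, has the same
  norm: pairing \<open>y = \<Sum>c\<^sub>i \<phi>\<^sub>i\<close> with itself gives \<open>\<parallel>y\<parallel>\<^sup>2 = \<Sum>c\<^sub>i \<langle>\<phi>\<^sub>i, y\<rangle>\<close>, to which the
  Cauchy--Schwarz inequality and the upper frame bound at \<open>y\<close> apply (\<open>norm_synthesis_finite\<close>).
  On finite sets of indices this bound controls the partial sums by those of a convergent series of
  squares, so it gives unconditional convergence as well (\<open>summable_on_quadratic_domination\<close>).

  The second estimate comes from \<open>\<langle>S x, x\<rangle> = Q\<close>: hence \<open>Q \<le> \<parallel>S x\<parallel> * \<parallel>x\<parallel>\<close>, and
  \<open>A * \<parallel>x\<parallel>\<^sup>2 \<le> Q\<close> allows \<open>\<parallel>x\<parallel>\<close> to be eliminated (\<open>frame_expansion_lower_bound\<close>).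

  The constants themselves are least elements of sets of reals, about which the inequalities say
  something only if the least elements exist. Each set is closed, and it is bounded below as soon
  as \<open>S x \<noteq> 0\<close> for some \<open>x\<close>. Here the optimality of \<open>A\<close> enters: on the zero space every positive
  number is a lower frame bound, so none is largest.
\<close>

section \<open>Quadratic domination of unordered sums\<close>

text \<open>
  The bound holds for differences of partial sums too, so the partial sums of \<open>f\<close> inherit the
  Cauchy property from those of \<open>g\<close>. Absolute convergence of \<open>f\<close> does not follow in general,
  which is why no comparison test applies.
\<close>

lemma summable_on_quadratic_domination:
  fixes f :: "'i \<Rightarrow> 'b::banach" and g :: "'i \<Rightarrow> real"
  assumes g: "g summable_on J" "\<And>i. i \<in> J \<Longrightarrow> 0 \<le> g i" and K: "0 \<le> K"
    and fg: "\<And>F. finite F \<Longrightarrow> F \<subseteq> J \<Longrightarrow> (norm (sum f F))\<^sup>2 \<le> K * sum g F"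
  shows "f summable_on J" and "(norm (infsum f J))\<^sup>2 \<le> K * infsum g J"
proof -
  have "\<exists>P. eventually P (finite_subsets_at_top J) \<and>
          (\<forall>F F'. P F \<and> P F' \<longrightarrow> dist (sum f F) (sum f F') < e)" if "e > 0" for e
  proof -
    \<comment> \<open>The denominator \<open>K + 1\<close> instead of \<open>K\<close> covers \<open>K = 0\<close> and makes \<open>K * d < (e / 2)\<^sup>2\<close> strict.\<close>
    define d where "d = (e / 2)\<^sup>2 / (K + 1)"
    have "d > 0" using \<open>e > 0\<close> K by (simp add: d_def)
    have "((\<lambda>F. sum g F) \<longlongrightarrow> infsum g J) (finite_subsets_at_top J)"
      using g(1) by (rule infsum_tendsto)
    then have "\<forall>\<^sub>F F in finite_subsets_at_top J. dist (sum g F) (infsum g J) < d"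
      using \<open>d > 0\<close> by (rule tendstoD)
    then obtain G where G: "finite G" "G \<subseteq> J"
      and near: "\<forall>F. finite F \<and> G \<subseteq> F \<and> F \<subseteq> J \<longrightarrow> dist (sum g F) (infsum g J) < d"
      unfolding eventually_finite_subsets_at_top by (elim exE conjE)
    have "dist (sum g G) (infsum g J) < d"
      using near G by simp
    then have "infsum g J - sum g G < d"
      by (simp add: dist_real_def abs_less_iff)
    have close: "dist (sum f F) (sum f G) < e / 2" if F: "finite F" "F \<subseteq> J" "G \<subseteq> F" for F
    proof -
      have "(norm (sum f (F - G)))\<^sup>2 \<le> K * sum g (F - G)"
        using F by (intro fg) auto
      also have "sum g (F - G) = sum g F - sum g G"
        using F by (simp add: sum_diff)
      also have "K * (sum g F - sum g G) \<le> K * d"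
      proof (rule mult_left_mono[OF _ K])
        have "sum g F \<le> infsum g J"
          using F g by (intro finite_sum_le_infsum) auto
        then show "sum g F - sum g G \<le> d"
          using \<open>infsum g J - sum g G < d\<close> by simp
      qed
      also have "K * d < (e / 2)\<^sup>2"
      proof -
        have "K * d < (K + 1) * d" using \<open>d > 0\<close> by simp
        also have "(K + 1) * d = (e / 2)\<^sup>2" using K by (simp add: d_def)
        finally show ?thesis .
      qed
      finally have "norm (sum f (F - G)) < e / 2"
        using \<open>e > 0\<close> by (intro power_less_imp_less_base[of _ 2 "e / 2"]) simp_all
      then show ?thesis
        using F by (simp add: sum_diff dist_norm)
    qed
    show ?thesis
    proof (intro exI conjI allI impI)
      show "eventually (\<lambda>F. finite F \<and> G \<subseteq> F \<and> F \<subseteq> J) (finite_subsets_at_top J)"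
        unfolding eventually_finite_subsets_at_top using G by blast
      show "dist (sum f F) (sum f F') < e"
        if "(finite F \<and> G \<subseteq> F \<and> F \<subseteq> J) \<and> (finite F' \<and> G \<subseteq> F' \<and> F' \<subseteq> J)" for F F'
        using that close[of F] close[of F'] dist_triangle2[of "sum f F" "sum f F'" "sum f G"]
        by auto
    qed
  qed
  then have "cauchy_filter (filtermap (sum f) (finite_subsets_at_top J))"
    by (simp add: cauchy_filter_metric_filtermap)
  moreover have "complete (UNIV :: 'b set)"
    by (meson Cauchy_convergent UNIV_I complete_def convergent_def)
  ultimately obtain l where "(sum f \<longlongrightarrow> l) (finite_subsets_at_top J)"
    using complete_uniform[where S = UNIV] by (force simp add: filterlim_def)
  then show f: "f summable_on J"
    using summable_on_def has_sum_def by blast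
  show "(norm (infsum f J))\<^sup>2 \<le> K * infsum g J"
  proof (rule tendsto_upperbound)
    show "((\<lambda>F. (norm (sum f F))\<^sup>2) \<longlongrightarrow> (norm (infsum f J))\<^sup>2) (finite_subsets_at_top J)"
      by (intro tendsto_intros infsum_tendsto f)
    have "(norm (sum f F))\<^sup>2 \<le> K * infsum g J" if F: "finite F" "F \<subseteq> J" for F
    proof -
      have "sum g F \<le> infsum g J"
        using F g by (intro finite_sum_le_infsum) auto
      then show ?thesis
        using fg[OF F] mult_left_mono[OF _ K] by (meson order_trans)
    qed
    then show "\<forall>\<^sub>F F in finite_subsets_at_top J. (norm (sum f F))\<^sup>2 \<le> K * infsum g J"
      by (intro eventually_finite_subsets_at_top_weakI)
  qed simp
qed

section \<open>Least real constants\<close>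

text \<open>
  \<open>LEAST\<close> on the reals has no value of interest unless a minimum is attained, which closedness
  and boundedness from below ensure.
\<close>

lemma Least_real_le:
  fixes P :: "real \<Rightarrow> bool"
  assumes "closed {C. P C}" and "\<And>C. P C \<Longrightarrow> m \<le> C" and "P K"
  shows "(LEAST C. P C) \<le> K"
proof -
  have bdd: "bdd_below {C. P C}"
    using assms(2) by (auto intro!: bdd_belowI[of _ m])
  have "Inf {C. P C} \<in> {C. P C}"
    using assms(1,3) bdd by (intro closed_contains_Inf) auto
  then have "(LEAST C. P C) = Inf {C. P C}"
    using bdd by (intro Least_equality) (auto intro: cInf_lower)
  also have "\<dots> \<le> K"
    using assms(3) bdd by (auto intro: cInf_lower)
  finally show ?thesis .
qed

section \<open>Conjugation and the inner product\<close>

lemma norm_conjugate [simp]: "norm (conjugate a) = norm (a :: 'k::real_or_complex)"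
proof (cases "a = 0")
  case True
  have "conjugate (0 :: 'k) = 0"
    using conjugate_add[of "0 :: 'k" 0] by simp
  with True show ?thesis by simp
next
  case False
  have "norm a * norm (conjugate a) = norm a * norm a"
    using arg_cong[OF mult_conjugate[of a], of norm] by (simp add: norm_mult power2_eq_square)
  with False show ?thesis by simp
qed

lemma conjugate_of_real [simp]: "conjugate (of_real r :: 'k::real_or_complex) = of_real r"
proof (cases "r = 0")
  case True
  have "norm (conjugate (0 :: 'k)) = 0" unfolding norm_conjugate by simp
  then have "conjugate (0 :: 'k) = 0" by (simp only: norm_eq_zero)
  with True show ?thesis by simp
next
  case False
  have "of_real r * conjugate (of_real r :: 'k) = of_real r * of_real r"
    using mult_conjugate[of "of_real r :: 'k"] by (simp add: of_real_def power2_eq_square)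
  with False show ?thesis by simp
qed

context hilbert_space
begin

lemma ip_zero_left [simp]: "ip 0 y = 0"
  using ip_add_left[of 0 0 y] by simp

lemma ip_commute_norm: "norm (ip y x) = norm (ip x y)"
  by (subst ip_commute) simp

lemma ip_mult_swap: "ip x y * ip y x = of_real ((norm (ip x y))\<^sup>2)"
  by (subst (2) ip_commute) (simp only: mult_conjugate of_real_def)

lemma ip_diff_left: "ip (x - y) z = ip x z - ip y z"
  using ip_add_left[of "x - y" y z] by simp

text \<open>
  Expanding \<open>\<langle>z, z\<rangle> \<ge> 0\<close> for \<open>z = \<parallel>y\<parallel>\<^sup>2 x - \<langle>x, y\<rangle> y\<close>, which is \<open>\<parallel>y\<parallel>\<^sup>2\<close> times the component
  of \<open>x\<close> orthogonal to \<open>y\<close>.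
\<close>

lemma norm_ip_le: "norm (ip x y) \<le> norm x * norm y"
proof (cases "y = 0")
  case True
  then show ?thesis using ip_commute_norm[of x 0] by simp
next
  case False
  define s where "s = (norm y)\<^sup>2"
  define c where "c = ip x y"
  define z where "z = scale (of_real s) x - scale c y"
  define t where "t = s * (norm x)\<^sup>2 - (norm c)\<^sup>2"
  have "s > 0" using False by (simp add: s_def)
  have zy: "ip z y = 0"
    by (simp add: z_def ip_diff_left ip_scale_left ip_self s_def c_def mult.commute)
  have zx: "ip z x = of_real t"
    by (simp add: z_def t_def c_def ip_diff_left ip_scale_left ip_self ip_mult_swap)
  have "ip y z = 0" using zy ip_commute_norm[of y z] by simp
  moreover have "ip x z = of_real t" using ip_commute[of x z] zx by simp
  ultimately have "ip z z = of_real (s * t)"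
    by (subst z_def) (simp add: ip_diff_left ip_scale_left)
  then have "(norm z)\<^sup>2 = s * t"
    unfolding ip_self by (simp only: of_real_eq_iff)
  then have "0 \<le> s * t" by (metis zero_le_power2)
  then have "0 \<le> t" using \<open>s > 0\<close> by (simp add: zero_le_mult_iff)
  then have "(norm c)\<^sup>2 \<le> (norm x * norm y)\<^sup>2"
    by (simp add: t_def s_def power_mult_distrib mult.commute)
  then show ?thesis
    unfolding c_def by (rule power2_le_imp_le) simp
qed

lemma bounded_linear_ip_left: "bounded_linear (\<lambda>x. ip x y)"
proof (rule bounded_linear_intro)
  show "ip (a + b) y = ip a y + ip b y" for a b by (rule ip_add_left)
  show "ip (r *\<^sub>R a) y = r *\<^sub>R ip a y" for r a
    by (metis ip_scale_left scale_of_real scaleR_conv_of_real)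
  show "norm (ip a y) \<le> norm a * norm y" for a by (rule norm_ip_le)
qed

section \<open>The two frame estimates\<close>

text \<open>
  Pairing the sum \<open>y\<close> with itself turns the left-hand side into \<open>\<Sum>c\<^sub>i \<langle>\<phi>\<^sub>i, y\<rangle>\<close>, where the upper
  frame bound at \<open>y\<close> controls the second factors; one power of \<open>\<parallel>y\<parallel>\<close> then cancels.
\<close>

lemma norm_synthesis_finite:
  assumes "upper_frame_bound ip I \<phi> B" and F: "finite F" "F \<subseteq> I"
  shows "(norm (\<Sum>i\<in>F. scale (c i) (\<phi> i)))\<^sup>2 \<le> B * (\<Sum>i\<in>F. (norm (c i))\<^sup>2)"
proof -
  define y where "y = (\<Sum>i\<in>F. scale (c i) (\<phi> i))"
  define q where "q = (\<Sum>i\<in>F. (norm (c i))\<^sup>2)"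
  have "0 \<le> q" by (simp add: q_def sum_nonneg)
  have "0 < B" using assms(1) by (simp add: upper_frame_bound_def)
  have summable: "(\<lambda>i. (norm (ip y (\<phi> i)))\<^sup>2) summable_on I"
    and upper: "(\<Sum>\<^sub>\<infinity>i\<in>I. (norm (ip y (\<phi> i)))\<^sup>2) \<le> B * (norm y)\<^sup>2"
    using assms(1) unfolding upper_frame_bound_def by blast+
  have "ip y y = (\<Sum>i\<in>F. c i * ip (\<phi> i) y)"
    unfolding y_def
    by (subst bounded_linear.linear[OF bounded_linear_ip_left, THEN linear_sum])
      (simp add: ip_scale_left)
  then have "norm (ip y y) \<le> (\<Sum>i\<in>F. norm (c i) * norm (ip y (\<phi> i)))"
    by (simp add: sum_norm_le norm_mult ip_commute_norm[of y])
  then have "(norm y)\<^sup>2 \<le> (\<Sum>i\<in>F. norm (c i) * norm (ip y (\<phi> i)))"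
    unfolding ip_self norm_of_real by simp
  then have "((norm y)\<^sup>2)\<^sup>2 \<le> (\<Sum>i\<in>F. norm (c i) * norm (ip y (\<phi> i)))\<^sup>2"
    by (intro power_mono) auto
  also have "\<dots> \<le> q * (\<Sum>i\<in>F. (norm (ip y (\<phi> i)))\<^sup>2)"
    unfolding q_def by (rule Cauchy_Schwarz_ineq_sum)
  also have "\<dots> \<le> q * (B * (norm y)\<^sup>2)"
  proof (rule mult_left_mono[OF _ \<open>0 \<le> q\<close>])
    have "(\<Sum>i\<in>F. (norm (ip y (\<phi> i)))\<^sup>2) \<le> (\<Sum>\<^sub>\<infinity>i\<in>I. (norm (ip y (\<phi> i)))\<^sup>2)"
      using summable F by (intro finite_sum_le_infsum) auto
    then show "(\<Sum>i\<in>F. (norm (ip y (\<phi> i)))\<^sup>2) \<le> B * (norm y)\<^sup>2"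
      using upper by simp
  qed
  finally have "(norm y)\<^sup>2 * (norm y)\<^sup>2 \<le> (B * q) * (norm y)\<^sup>2"
    by (simp add: power2_eq_square mult_ac)
  then have "(norm y)\<^sup>2 \<le> B * q"
    using \<open>0 \<le> q\<close> \<open>0 < B\<close> mult_right_le_imp_le[of "(norm y)\<^sup>2" "(norm y)\<^sup>2" "B * q"]
    by (cases "y = 0") simp_all
  then show ?thesis by (simp add: y_def q_def)
qed

text \<open>
  Dropping indices or shrinking coefficients can only decrease the sum of squares by which the
  synthesis map is bounded, so one bound serves subsets, signs and general multipliers alike.
\<close>

lemma norm_multiplier_le:
  assumes upper: "upper_frame_bound ip I \<phi> B" and J: "J \<subseteq> I"
    and a: "\<And>i. i \<in> J \<Longrightarrow> norm (a i) \<le> 1"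
  shows "(\<lambda>i. scale (a i) (frame_term scale ip \<phi> x i)) summable_on J"
    and "(norm (\<Sum>\<^sub>\<infinity>i\<in>J. scale (a i) (frame_term scale ip \<phi> x i)))\<^sup>2
           \<le> B * (\<Sum>\<^sub>\<infinity>i\<in>I. (norm (ip x (\<phi> i)))\<^sup>2)"
proof -
  let ?g = "\<lambda>i. (norm (ip x (\<phi> i)))\<^sup>2"
  have summable: "?g summable_on I" and "0 < B"
    using upper by (auto simp: upper_frame_bound_def)
  then have summable_J: "?g summable_on J"
    using J summable_on_subset_banach by blast
  have dominated:
    "(norm (\<Sum>i\<in>F. scale (a i) (frame_term scale ip \<phi> x i)))\<^sup>2 \<le> B * sum ?g F"
    if F: "finite F" "F \<subseteq> J" for F
  proof -
    have "(norm (\<Sum>i\<in>F. scale (a i) (frame_term scale ip \<phi> x i)))\<^sup>2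
        \<le> B * (\<Sum>i\<in>F. (norm (a i * ip x (\<phi> i)))\<^sup>2)"
      using norm_synthesis_finite[OF upper, of F "\<lambda>i. a i * ip x (\<phi> i)"] F J
      by (auto simp: frame_term_def)
    also have "\<dots> \<le> B * sum ?g F"
      using a F \<open>0 < B\<close>
      by (intro mult_left_mono sum_mono power_mono)
        (auto simp: norm_mult intro!: mult_left_le_one_le)
    finally show ?thesis .
  qed
  show "(\<lambda>i. scale (a i) (frame_term scale ip \<phi> x i)) summable_on J"
    by (rule summable_on_quadratic_domination(1)[OF summable_J _ _ dominated])
      (use \<open>0 < B\<close> in auto)
  have "(norm (\<Sum>\<^sub>\<infinity>i\<in>J. scale (a i) (frame_term scale ip \<phi> x i)))\<^sup>2 \<le> B * infsum ?g J"
    by (rule summable_on_quadratic_domination(2)[OF summable_J _ _ dominated])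
      (use \<open>0 < B\<close> in auto)
  also have "\<dots> \<le> B * infsum ?g I"
    using \<open>0 < B\<close> summable summable_J J by (intro mult_left_mono infsum_mono2) auto
  finally show "(norm (\<Sum>\<^sub>\<infinity>i\<in>J. scale (a i) (frame_term scale ip \<phi> x i)))\<^sup>2
      \<le> B * infsum ?g I" .
qed

lemma ip_frame_expansion:
  assumes "frame_term scale ip \<phi> x summable_on I"
    and "(\<lambda>i. (norm (ip x (\<phi> i)))\<^sup>2) summable_on I"
  shows "ip (frame_expansion scale ip I \<phi> x) x = of_real (\<Sum>\<^sub>\<infinity>i\<in>I. (norm (ip x (\<phi> i)))\<^sup>2)"
proof -
  have "((\<lambda>i. ip (frame_term scale ip \<phi> x i) x) has_sum ip (frame_expansion scale ip I \<phi> x) x) I"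
    unfolding frame_expansion_def
    by (rule has_sum_bounded_linear[OF bounded_linear_ip_left has_sum_infsum[OF assms(1)]])
  then have *: "((\<lambda>i. of_real ((norm (ip x (\<phi> i)))\<^sup>2))
      has_sum ip (frame_expansion scale ip I \<phi> x) x) I"
    by (simp only: frame_term_def ip_scale_left ip_mult_swap)
  show ?thesis
  proof (rule has_sum_unique[OF *])
    show "((\<lambda>i. of_real ((norm (ip x (\<phi> i)))\<^sup>2) :: 'k)
        has_sum of_real (\<Sum>\<^sub>\<infinity>i\<in>I. (norm (ip x (\<phi> i)))\<^sup>2)) I"
      by (rule has_sum_bounded_linear[OF bounded_linear_of_real has_sum_infsum[OF assms(2)]])
  qed
qed

text \<open>
  With \<open>Q = \<langle>S x, x\<rangle>\<close>, the Cauchy--Schwarz inequality and the lower frame bound give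
  \<open>A * Q\<^sup>2 \<le> \<parallel>S x\<parallel>\<^sup>2 * (A * \<parallel>x\<parallel>\<^sup>2) \<le> \<parallel>S x\<parallel>\<^sup>2 * Q\<close>. Bounding \<open>Q\<close> by
  \<open>B * \<parallel>x\<parallel>\<^sup>2\<close> instead would lead to the constant \<open>B / A\<close> without the square root.
\<close>

lemma frame_expansion_lower_bound:
  assumes lower: "lower_frame_bound ip I \<phi> A"
    and summable: "frame_term scale ip \<phi> x summable_on I"
  shows "A * (\<Sum>\<^sub>\<infinity>i\<in>I. (norm (ip x (\<phi> i)))\<^sup>2) \<le> (norm (frame_expansion scale ip I \<phi> x))\<^sup>2"
proof -
  define Q where "Q = (\<Sum>\<^sub>\<infinity>i\<in>I. (norm (ip x (\<phi> i)))\<^sup>2)"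
  define s where "s = norm (frame_expansion scale ip I \<phi> x)"
  have "0 < A" and AQ: "A * (norm x)\<^sup>2 \<le> Q"
    and squares: "(\<lambda>i. (norm (ip x (\<phi> i)))\<^sup>2) summable_on I"
    using lower by (auto simp: lower_frame_bound_def Q_def)
  have "0 \<le> Q" unfolding Q_def by (intro infsum_nonneg) auto
  have "Q = norm (ip (frame_expansion scale ip I \<phi> x) x)"
    using \<open>0 \<le> Q\<close> by (simp add: ip_frame_expansion[OF summable squares] flip: Q_def)
  also have "\<dots> \<le> s * norm x" unfolding s_def by (rule norm_ip_le)
  finally have "Q\<^sup>2 \<le> (s * norm x)\<^sup>2" using \<open>0 \<le> Q\<close> by (intro power_mono) auto
  then have "A * Q\<^sup>2 \<le> A * (s * norm x)\<^sup>2"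
    using \<open>0 < A\<close> by simp
  also have "\<dots> = s\<^sup>2 * (A * (norm x)\<^sup>2)" by (simp add: power_mult_distrib)
  also have "\<dots> \<le> s\<^sup>2 * Q" using AQ by (intro mult_left_mono) auto
  finally have "(A * Q) * Q \<le> s\<^sup>2 * Q" by (simp add: power2_eq_square mult_ac)
  then have "A * Q \<le> s\<^sup>2"
    using \<open>0 \<le> Q\<close> mult_right_le_imp_le[of "A * Q" Q "s\<^sup>2"] by (cases "Q = 0") simp_all
  then show ?thesis by (simp add: Q_def s_def)
qed

lemma frame_term_summable:
  assumes "upper_frame_bound ip I \<phi> B" and "J \<subseteq> I"
  shows "frame_term scale ip \<phi> x summable_on J"
  using norm_multiplier_le(1)[OF assms, of "\<lambda>_. 1" x] by simp

theorem norm_multiplier_le_frame_expansion: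
  assumes lower: "lower_frame_bound ip I \<phi> A" and upper: "upper_frame_bound ip I \<phi> B"
    and J: "J \<subseteq> I" and a: "\<And>i. i \<in> J \<Longrightarrow> norm (a i) \<le> 1"
  shows "norm (\<Sum>\<^sub>\<infinity>i\<in>J. scale (a i) (frame_term scale ip \<phi> x i))
           \<le> sqrt (B / A) * norm (frame_expansion scale ip I \<phi> x)" (is "norm ?T \<le> _ * norm ?S")
proof -
  define Q where "Q = (\<Sum>\<^sub>\<infinity>i\<in>I. (norm (ip x (\<phi> i)))\<^sup>2)"
  have "0 < A" and "0 < B"
    using lower upper by (auto simp: lower_frame_bound_def upper_frame_bound_def)
  then have ratio: "0 \<le> B / A" by simp
  have "A * Q \<le> (norm ?S)\<^sup>2"
    unfolding Q_def using frame_term_summable[OF upper order_refl]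
    by (rule frame_expansion_lower_bound[OF lower])
  have "(norm ?T)\<^sup>2 \<le> B * Q"
    unfolding Q_def by (rule norm_multiplier_le(2)[OF upper J]) (rule a)
  also have "B * Q = B / A * (A * Q)" using \<open>0 < A\<close> by simp
  also have "\<dots> \<le> B / A * (norm ?S)\<^sup>2"
    using \<open>A * Q \<le> (norm ?S)\<^sup>2\<close> ratio by (rule mult_left_mono)
  also have "\<dots> = (sqrt (B / A) * norm ?S)\<^sup>2"
    using ratio by (simp only: power_mult_distrib real_sqrt_pow2)
  finally show ?thesis
    by (rule power2_le_imp_le) (intro mult_nonneg_nonneg real_sqrt_ge_zero ratio norm_ge_zero)
qed

section \<open>Frame expansions that do not vanish\<close>

text \<open>
  A nonzero vector exists, since otherwise \<open>A + 1\<close> would be a lower frame bound too; its expansion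
  is nonzero by the lower estimate.
\<close>

lemma optimal_frame_bounds_nonzero_expansion:
  assumes "optimal_frame_bounds ip I \<phi> A B"
  obtains x where "0 < norm (frame_expansion scale ip I \<phi> x)"
proof -
  have lower: "lower_frame_bound ip I \<phi> A" and upper: "upper_frame_bound ip I \<phi> B"
    and largest: "\<And>A'. lower_frame_bound ip I \<phi> A' \<Longrightarrow> A' \<le> A"
    using assms by (auto simp: optimal_frame_bounds_def)
  have "0 < A" using lower by (simp add: lower_frame_bound_def)
  obtain x :: 'h where "x \<noteq> 0"
  proof (rule ccontr)
    assume "\<not> thesis"
    with that have "y = 0" for y :: 'h by blast
    then have "norm y = 0" for y :: 'h unfolding norm_eq_zero .
    then have zero: "(norm y)\<^sup>2 = 0" for y :: 'h by simp
    have "lower_frame_bound ip I \<phi> (A + 1)"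
      using lower unfolding lower_frame_bound_def zero by simp
    then show False using largest[of "A + 1"] by simp
  qed
  then have "0 < A * (A * (norm x)\<^sup>2)" using \<open>0 < A\<close> by simp
  also have "\<dots> \<le> A * (\<Sum>\<^sub>\<infinity>i\<in>I. (norm (ip x (\<phi> i)))\<^sup>2)"
    using lower \<open>0 < A\<close> by (simp add: lower_frame_bound_def)
  also have "\<dots> \<le> (norm (frame_expansion scale ip I \<phi> x))\<^sup>2"
    using frame_term_summable[OF upper order_refl]
    by (rule frame_expansion_lower_bound[OF lower])
  finally have "0 < norm (frame_expansion scale ip I \<phi> x)" by auto
  then show thesis by (rule that)
qed

end

section \<open>Bounds on the unconditional constants\<close>

theorem proposition3p1:
  fixes smul :: "'k::real_or_complex \<Rightarrow> 'h::banach \<Rightarrow> 'h"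
    and ip :: "'h \<Rightarrow> 'h \<Rightarrow> 'k"
    and I :: "nat set" and \<phi> :: "nat \<Rightarrow> 'h" and A B :: real
  assumes "hilbert_space smul ip"
    and "separable_space (euclidean :: 'h topology)"
    and "(\<exists>N. I = {1..N}) \<or> I = UNIV"
    and "is_frame ip I \<phi>"
    and "optimal_frame_bounds ip I \<phi> A B"
  shows "C_sigma smul ip I \<phi> \<le> sqrt (B / A) \<and>
    C_epsilon smul ip I \<phi> \<le> sqrt (B / A) \<and>
    C_a smul ip I \<phi> \<le> sqrt (B / A) \<and>
    (\<forall>\<sigma>\<subseteq>I. \<forall>x.
      frame_term smul ip \<phi> x summable_on \<sigma> \<and>
      norm (\<Sum>\<^sub>\<infinity>i\<in>\<sigma>. frame_term smul ip \<phi> x i)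
        \<le> sqrt (B / A) * norm (frame_expansion smul ip I \<phi> x)) \<and>
    (\<forall>\<epsilon> :: nat \<Rightarrow> 'k. (\<forall>i\<in>I. \<epsilon> i \<in> {-1, 1}) \<longrightarrow> (\<forall>x.
      (\<lambda>i. smul (\<epsilon> i) (frame_term smul ip \<phi> x i)) summable_on I \<and>
      norm (\<Sum>\<^sub>\<infinity>i\<in>I. smul (\<epsilon> i) (frame_term smul ip \<phi> x i))
        \<le> sqrt (B / A) * norm (frame_expansion smul ip I \<phi> x))) \<and>
    (\<forall>a :: nat \<Rightarrow> real. (\<forall>i\<in>I. \<bar>a i\<bar> \<le> 1) \<longrightarrow> (\<forall>x.
      (\<lambda>i. smul (of_real (a i)) (frame_term smul ip \<phi> x i)) summable_on I \<and>
      norm (\<Sum>\<^sub>\<infinity>i\<in>I. smul (of_real (a i)) (frame_term smul ip \<phi> x i))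
        \<le> sqrt (B / A) * norm (frame_expansion smul ip I \<phi> x)))"
proof -
  interpret hilbert_space smul ip by fact
  have lower: "lower_frame_bound ip I \<phi> A" and upper: "upper_frame_bound ip I \<phi> B"
    using assms(5) by (auto simp: optimal_frame_bounds_def)
  obtain x0 where x0: "0 < norm (frame_expansion smul ip I \<phi> x0)"
    using assms(5) by (rule optimal_frame_bounds_nonzero_expansion)
  note multiplier = norm_multiplier_le(1)[OF upper]
    norm_multiplier_le_frame_expansion[OF lower upper]
  note closed_intros = closed_Collect_all closed_Collect_imp open_Collect_const
    closed_Collect_conj closed_Collect_const closed_Collect_le continuous_intros
  have nonneg: "0 \<le> C" if "norm (y :: 'h) \<le> C * norm (frame_expansion smul ip I \<phi> x0)" for C y
    using order_trans[OF norm_ge_zero that] x0 by (simp add: zero_le_mult_iff)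

  have sigma: "\<forall>x. \<forall>\<sigma>\<subseteq>I. frame_term smul ip \<phi> x summable_on \<sigma> \<and>
      norm (\<Sum>\<^sub>\<infinity>i\<in>\<sigma>. frame_term smul ip \<phi> x i)
        \<le> sqrt (B / A) * norm (frame_expansion smul ip I \<phi> x)"
    using multiplier[where a = "\<lambda>_. 1"] by simp
  have scalars: "\<forall>x. \<forall>a :: nat \<Rightarrow> 'k. (\<forall>i\<in>I. norm (a i) \<le> 1) \<longrightarrow>
      (\<lambda>i. smul (a i) (frame_term smul ip \<phi> x i)) summable_on I \<and>
      norm (\<Sum>\<^sub>\<infinity>i\<in>I. smul (a i) (frame_term smul ip \<phi> x i))
        \<le> sqrt (B / A) * norm (frame_expansion smul ip I \<phi> x)"
    using multiplier[OF order_refl] by simp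
  have signs: "\<forall>x. \<forall>\<epsilon> :: nat \<Rightarrow> 'k. (\<forall>i\<in>I. \<epsilon> i \<in> {-1, 1}) \<longrightarrow>
      (\<lambda>i. smul (\<epsilon> i) (frame_term smul ip \<phi> x i)) summable_on I \<and>
      norm (\<Sum>\<^sub>\<infinity>i\<in>I. smul (\<epsilon> i) (frame_term smul ip \<phi> x i))
        \<le> sqrt (B / A) * norm (frame_expansion smul ip I \<phi> x)"
  proof (intro allI impI)
    fix x and \<epsilon> :: "nat \<Rightarrow> 'k"
    assume "\<forall>i\<in>I. \<epsilon> i \<in> {-1, 1}"
    then have "\<forall>i\<in>I. norm (\<epsilon> i) \<le> 1" by force
    then show "(\<lambda>i. smul (\<epsilon> i) (frame_term smul ip \<phi> x i)) summable_on I \<and>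
      norm (\<Sum>\<^sub>\<infinity>i\<in>I. smul (\<epsilon> i) (frame_term smul ip \<phi> x i))
        \<le> sqrt (B / A) * norm (frame_expansion smul ip I \<phi> x)"
      using scalars by blast
  qed

  have "C_sigma smul ip I \<phi> \<le> sqrt (B / A)"
    unfolding C_sigma_def
  proof (rule Least_real_le[where m = 0])
    show "0 \<le> C" if "\<forall>x. \<forall>\<sigma>\<subseteq>I. frame_term smul ip \<phi> x summable_on \<sigma> \<and>
        norm (\<Sum>\<^sub>\<infinity>i\<in>\<sigma>. frame_term smul ip \<phi> x i) \<le> C * norm (frame_expansion smul ip I \<phi> x)" for C
      using that[rule_format, of I x0] by (auto intro: nonneg)
  qed (intro closed_intros, rule sigma)
  moreover have "C_epsilon smul ip I \<phi> \<le> sqrt (B / A)"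
    unfolding C_epsilon_def
  proof (rule Least_real_le[where m = 0])
    show "0 \<le> C" if "\<forall>x. \<forall>\<epsilon> :: nat \<Rightarrow> 'k. (\<forall>i\<in>I. \<epsilon> i \<in> {-1, 1}) \<longrightarrow>
        (\<lambda>i. smul (\<epsilon> i) (frame_term smul ip \<phi> x i)) summable_on I \<and>
        norm (\<Sum>\<^sub>\<infinity>i\<in>I. smul (\<epsilon> i) (frame_term smul ip \<phi> x i))
          \<le> C * norm (frame_expansion smul ip I \<phi> x)" for C
      using that[rule_format, of "\<lambda>_. 1" x0] by (auto intro: nonneg)
  qed (intro closed_intros, rule signs)
  moreover have "C_a smul ip I \<phi> \<le> sqrt (B / A)"
    unfolding C_a_def
  proof (rule Least_real_le[where m = 0])
    show "0 \<le> C" if "\<forall>x. \<forall>a :: nat \<Rightarrow> 'k. (\<forall>i\<in>I. norm (a i) \<le> 1) \<longrightarrow>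
        (\<lambda>i. smul (a i) (frame_term smul ip \<phi> x i)) summable_on I \<and>
        norm (\<Sum>\<^sub>\<infinity>i\<in>I. smul (a i) (frame_term smul ip \<phi> x i))
          \<le> C * norm (frame_expansion smul ip I \<phi> x)" for C
      using that[rule_format, of "\<lambda>_. 1" x0] by (auto intro: nonneg)
  qed (intro closed_intros, rule scalars)
  moreover have "\<forall>a :: nat \<Rightarrow> real. (\<forall>i\<in>I. \<bar>a i\<bar> \<le> 1) \<longrightarrow> (\<forall>x.
      (\<lambda>i. smul (of_real (a i)) (frame_term smul ip \<phi> x i)) summable_on I \<and>
      norm (\<Sum>\<^sub>\<infinity>i\<in>I. smul (of_real (a i)) (frame_term smul ip \<phi> x i))
        \<le> sqrt (B / A) * norm (frame_expansion smul ip I \<phi> x))"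
    using scalars by simp
  ultimately show ?thesis
    using sigma signs by blast
qed

end
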